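(* Let $T$ be any task, with task misalignments $r_p$ (of the verifier) and $r_q$ (of the drafter) and task-wise acceptance $\alpha_T$. If $r_p\le r_q$, then $$\big|\alpha_T-(1-r_q)\big|\;\le\; r_p .$$
   Context: Let $\mathcal V$ be a finite vocabulary and $\mathcal V^*$ the set of finite sequences (prefixes) over $\mathcal V$. For each prefix $s\in\mathcal V^*$, $p(\cdot\mid s)$ (verifier) and $q(\cdot\mid s)$ (drafter) are probability distributions on $\mathcal V$. A task $T$ is a probability distribution on $\mathcal V^*$, together with a latent task posterior $u(\cdot\mid s)$, which for each prefix $s$ is a probability distribution on $\mathcal V$ (the conditional next-token distribution that generates the data of the task). Define: - Acceptance rate at $s$: $\alpha(s)=\sum_{x\in\mathcal V}\min\big(q(x\mid s),p(x\mid s)\big)$; task-wise acceptance: $\alpha_T=\mathbb E_{s\sim T}[\alpha(s)]$. - Task misalignments: $r_p=\mathbb E_{s\sim T}\big[\tfrac12\sum_{x\in\mathcal V}|u(x\mid s)-p(x\mid s)|\big]$ and $r_q=\mathbb E_{s\sim T}\big[\tfrac12\sum_{x\in\mathcal V}|u(x\mid s)-q(x\mid s)|\big]$. *)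

theory Defs
  imports "HOL-Probability.Probability"
begin

text \<open>
  The vocabulary is a type of class \<open>finite\<close> and a prefix is a list over it. Since the set of
  prefixes is countable, every probability distribution on it is a \<open>pmf\<close>.
\<close>

type_synonym 'v next_token = "'v list \<Rightarrow> 'v pmf"

record 'v task =
  prefix_dist :: "'v list pmf"
  posterior :: "'v next_token"

definition acceptance_at :: "'v::finite next_token \<Rightarrow> 'v next_token \<Rightarrow> 'v list \<Rightarrow> real" where
  "acceptance_at p q s = (\<Sum>x\<in>UNIV. min (pmf (q s) x) (pmf (p s) x))"

definition task_acceptance :: "'v::finite task \<Rightarrow> 'v next_token \<Rightarrow> 'v next_token \<Rightarrow> real" where
  "task_acceptance T p q = measure_pmf.expectation (prefix_dist T) (acceptance_at p q)"

definition misalignment :: "'v::finite task \<Rightarrow> 'v next_token \<Rightarrow> real" where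
  "misalignment T m = measure_pmf.expectation (prefix_dist T)
     (\<lambda>s. 1 / 2 * (\<Sum>x\<in>UNIV. \<bar>pmf (posterior T s) x - pmf (m s) x\<bar>))"

end

theory Submission
  imports Defs
begin

text \<open>
  The acceptance rate at a prefix is one minus the total variation distance between drafter and
  verifier. By the triangle inequality, replacing the verifier by the task posterior changes this
  distance by at most the distance between posterior and verifier; now integrate over the prefixes.
\<close>

definition total_variation :: "'v::finite pmf \<Rightarrow> 'v pmf \<Rightarrow> real" where
  "total_variation a b = 1 / 2 * (\<Sum>x\<in>UNIV. \<bar>pmf a x - pmf b x\<bar>)"

lemma sum_pmf_UNIV: "(\<Sum>x\<in>UNIV. pmf (a :: 'v::finite pmf) x) = 1"
  by (rule sum_pmf_eq_1) auto

lemma total_variation_nonneg: "0 \<le> total_variation a b"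
  by (simp add: total_variation_def sum_nonneg)

lemma total_variation_commute: "total_variation a b = total_variation b a"
  by (simp add: total_variation_def abs_minus_commute)

lemma total_variation_triangle:
  "total_variation a c \<le> total_variation a b + total_variation b c"
proof -
  have "(\<Sum>x\<in>UNIV. \<bar>pmf a x - pmf c x\<bar>)
      \<le> (\<Sum>x\<in>UNIV. \<bar>pmf a x - pmf b x\<bar> + \<bar>pmf b x - pmf c x\<bar>)"
    by (rule sum_mono) linarith
  then show ?thesis
    by (simp add: total_variation_def sum.distrib)
qed

text \<open>Pointwise, a minimum is the mean of the two numbers minus half their distance; the means
  sum to 1 because both masses do.\<close>

lemma sum_min_pmf: "(\<Sum>x\<in>UNIV. min (pmf a x) (pmf b x)) = 1 - total_variation a b"
proof -
  have "(\<Sum>x\<in>UNIV. min (pmf a x) (pmf b x))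
      = (\<Sum>x\<in>UNIV. (pmf a x + pmf b x) / 2 - \<bar>pmf a x - pmf b x\<bar> / 2)"
    by (intro sum.cong) (auto simp: min_def abs_if field_simps)
  also have "\<dots> = ((\<Sum>x\<in>UNIV. pmf a x) + (\<Sum>x\<in>UNIV. pmf b x)) / 2
      - (\<Sum>x\<in>UNIV. \<bar>pmf a x - pmf b x\<bar>) / 2"
    by (simp only: sum_subtractf sum.distrib flip: sum_divide_distrib)
  finally show ?thesis
    by (simp add: sum_pmf_UNIV total_variation_def)
qed

text \<open>The overlap computed in \<open>sum_min_pmf\<close> is nonnegative.\<close>

lemma total_variation_le_1: "total_variation a b \<le> 1"
  using sum_min_pmf[of a b] sum_nonneg[of UNIV "\<lambda>x. min (pmf a x) (pmf b x)"] by simp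

text \<open>Values in [0, 1] are integrable against a probability measure. This licenses the
  linearity and monotonicity of expectation used below.\<close>

lemma integrable_total_variation:
  "integrable (measure_pmf M) (\<lambda>s. total_variation (f s) (g s))"
  by (rule measure_pmf.integrable_const_bound[where B = 1])
    (auto simp: total_variation_nonneg total_variation_le_1)

lemma misalignment_eq_total_variation:
  "misalignment T m
    = measure_pmf.expectation (prefix_dist T) (\<lambda>s. total_variation (posterior T s) (m s))"
  by (simp add: misalignment_def total_variation_def)

lemma task_acceptance_eq_total_variation:
  "task_acceptance T p q
    = 1 - measure_pmf.expectation (prefix_dist T) (\<lambda>s. total_variation (q s) (p s))"
  by (simp add: task_acceptance_def acceptance_at_def[abs_def] sum_min_pmf
      integrable_total_variation)

theorem theorem2:
  fixes T :: "'v::finite task"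
    and p q :: "'v next_token"
  assumes "misalignment T p \<le> misalignment T q"
  shows "\<bar>task_acceptance T p q - (1 - misalignment T q)\<bar> \<le> misalignment T p"
proof -
  let ?E = "measure_pmf.expectation (prefix_dist T)"
  let ?u = "posterior T"
  \<comment> \<open>The constants 1 cancel, and linearity merges the two expectations.\<close>
  have "\<bar>task_acceptance T p q - (1 - misalignment T q)\<bar>
      = \<bar>?E (\<lambda>s. total_variation (?u s) (q s) - total_variation (q s) (p s))\<bar>"
    by (simp add: task_acceptance_eq_total_variation misalignment_eq_total_variation
        integrable_total_variation)
  also have "\<dots> \<le> ?E (\<lambda>s. \<bar>total_variation (?u s) (q s) - total_variation (q s) (p s)\<bar>)"
    by (rule integral_abs_bound)
  also have "\<dots> \<le> ?E (\<lambda>s. total_variation (?u s) (p s))"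
  proof (intro integral_mono integrable_abs Bochner_Integration.integrable_diff
      integrable_total_variation)
    fix s
    \<comment> \<open>Reverse triangle inequality: one triangle inequality for each sign of the
      difference, with midpoint \<open>p s\<close> in the first and \<open>?u s\<close> in the
      second. The midpoint is the last argument of \<open>of\<close>.\<close>
    show "\<bar>total_variation (?u s) (q s) - total_variation (q s) (p s)\<bar>
        \<le> total_variation (?u s) (p s)"
      using total_variation_triangle[of "?u s" "q s" "p s"]
        total_variation_triangle[of "q s" "p s" "?u s"]
      by (simp add: abs_le_iff total_variation_commute)
  qed
  finally show ?thesis
    by (simp add: misalignment_eq_total_variation)
qed

end
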